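(* A Nelson algebra $N$ is five-valued if and only if for every irreducible deductive system $D$ of $N$, the quotient $N/D$ is isomorphic to $C_i$ for some $2\le i\le 5$.
   Context: A Nelson algebra is an algebra $(N,1,\sim,\wedge,\vee,\to)$ of type $(0,1,2,2,2)$ satisfying, for all $x,y,z$: $x\wedge(x\vee y)=x$; $x\wedge(y\vee z)=(z\wedge x)\vee(y\wedge x)$; $\sim\sim x=x$; $\sim(x\vee y)=\sim x\vee\sim y$; $x\wedge\sim x=(x\wedge\sim x)\wedge(y\vee\sim y)$; $x\to x=1$; $x\to(y\to z)=(x\wedge y)\to z$; $x\wedge(x\to y)=x\wedge(\sim x\vee y)$. It is five-valued if it satisfies $((x\to z)\to y)\to(((y\to x)\to y)\to y)=1$. A deductive system of $N$ is a subset $D$ with $1\in D$ such that $x\in D$ and $x\to y\in D$ imply $y\in D$; it is proper if $D\ne N$, and irreducible if it is proper and $D=D_1\cap D_2$ with $D_1,D_2$ deductive systems implies $D=D_1$ or $D=D_2$. For a deductive system $D$, the relation $x\equiv_D y$ iff $x\to y,\ y\to x,\ \sim x\to\sim y,\ \sim y\to\sim x\in D$ is a congruence, and $N/D$ is the quotient algebra. For $n\ge2$, $C_n=\{\tfrac{j}{n-1}:0\le j\le n-1\}$ is the chain with min/max as lattice operations, $\sim x=1-x$, and $x\to y=1$ if $x\le y$ or $x\le\sim x$, and $x\to y=\sim x\vee y$ otherwise; it is a Nelson algebra.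
   Formalization: The De Morgan axiom, printed as ∼(x∨y)=∼x∨∼y, is read as the standard ∼(x∧y)=∼x∨∼y; the printed form fails in C_2 (x=1, y=0), although every C_n is said to be a Nelson algebra, and it forces N to have one element. *)

theory Defs
  imports "HOL-Algebra.Congruence" HOL.Rat
begin

text \<open>Algebras of the signature of Nelson algebras, with an explicit carrier. The bound 0
  and the lattice order are not part of the signature.\<close>

record 'a nelson = "'a partial_object" +
  one :: 'a  (\<open>\<one>\<index>\<close>)
  neg :: "'a \<Rightarrow> 'a"  (\<open>\<sim>\<index> _\<close> [90] 90)
  meet :: "'a \<Rightarrow> 'a \<Rightarrow> 'a"  (infixl \<open>\<sqinter>\<index>\<close> 70)
  join :: "'a \<Rightarrow> 'a \<Rightarrow> 'a"  (infixl \<open>\<squnion>\<index>\<close> 65)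
  imp :: "'a \<Rightarrow> 'a \<Rightarrow> 'a"  (infixr \<open>\<leadsto>\<index>\<close> 60)

locale nelson_algebra =
  fixes N :: "('a, 'b) nelson_scheme" (structure)
  assumes one_closed: "\<one> \<in> carrier N"
    and neg_closed: "x \<in> carrier N \<Longrightarrow> \<sim> x \<in> carrier N"
    and meet_closed: "\<lbrakk>x \<in> carrier N; y \<in> carrier N\<rbrakk> \<Longrightarrow> x \<sqinter> y \<in> carrier N"
    and join_closed: "\<lbrakk>x \<in> carrier N; y \<in> carrier N\<rbrakk> \<Longrightarrow> x \<squnion> y \<in> carrier N"
    and imp_closed: "\<lbrakk>x \<in> carrier N; y \<in> carrier N\<rbrakk> \<Longrightarrow> x \<leadsto> y \<in> carrier N"
    and meet_join_absorb: "\<lbrakk>x \<in> carrier N; y \<in> carrier N\<rbrakk> \<Longrightarrow> x \<sqinter> (x \<squnion> y) = x"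
    and meet_join_distrib:
      "\<lbrakk>x \<in> carrier N; y \<in> carrier N; z \<in> carrier N\<rbrakk>
        \<Longrightarrow> x \<sqinter> (y \<squnion> z) = (z \<sqinter> x) \<squnion> (y \<sqinter> x)"
    and neg_neg: "x \<in> carrier N \<Longrightarrow> \<sim> (\<sim> x) = x"
    and neg_meet: "\<lbrakk>x \<in> carrier N; y \<in> carrier N\<rbrakk> \<Longrightarrow> \<sim> (x \<sqinter> y) = \<sim> x \<squnion> \<sim> y"
    and kleene:
      "\<lbrakk>x \<in> carrier N; y \<in> carrier N\<rbrakk> \<Longrightarrow> x \<sqinter> \<sim> x = (x \<sqinter> \<sim> x) \<sqinter> (y \<squnion> \<sim> y)"
    and imp_self: "x \<in> carrier N \<Longrightarrow> x \<leadsto> x = \<one>"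
    and imp_imp:
      "\<lbrakk>x \<in> carrier N; y \<in> carrier N; z \<in> carrier N\<rbrakk> \<Longrightarrow> x \<leadsto> (y \<leadsto> z) = (x \<sqinter> y) \<leadsto> z"
    and meet_imp:
      "\<lbrakk>x \<in> carrier N; y \<in> carrier N\<rbrakk> \<Longrightarrow> x \<sqinter> (x \<leadsto> y) = x \<sqinter> (\<sim> x \<squnion> y)"

locale five_valued_nelson_algebra = nelson_algebra +
  assumes five_valued:
    "\<lbrakk>x \<in> carrier N; y \<in> carrier N; z \<in> carrier N\<rbrakk>
      \<Longrightarrow> ((x \<leadsto> z) \<leadsto> y) \<leadsto> (((y \<leadsto> x) \<leadsto> y) \<leadsto> y) = \<one>"

definition deductive_system :: "'a set \<Rightarrow> ('a, 'b) nelson_scheme \<Rightarrow> bool" where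
  "deductive_system D N \<longleftrightarrow>
    D \<subseteq> carrier N \<and> \<one>\<^bsub>N\<^esub> \<in> D \<and>
    (\<forall>x\<in>carrier N. \<forall>y\<in>carrier N. x \<in> D \<longrightarrow> x \<leadsto>\<^bsub>N\<^esub> y \<in> D \<longrightarrow> y \<in> D)"

definition irreducible_deductive_system :: "'a set \<Rightarrow> ('a, 'b) nelson_scheme \<Rightarrow> bool" where
  "irreducible_deductive_system D N \<longleftrightarrow>
    deductive_system D N \<and> D \<noteq> carrier N \<and>
    (\<forall>D1 D2. deductive_system D1 N \<longrightarrow> deductive_system D2 N \<longrightarrow>
       D = D1 \<inter> D2 \<longrightarrow> D = D1 \<or> D = D2)"

definition nelson_cong :: "('a, 'b) nelson_scheme \<Rightarrow> 'a set \<Rightarrow> ('a \<times> 'a) set" where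
  "nelson_cong N D = {(x, y). x \<in> carrier N \<and> y \<in> carrier N \<and>
     x \<leadsto>\<^bsub>N\<^esub> y \<in> D \<and> y \<leadsto>\<^bsub>N\<^esub> x \<in> D \<and>
     \<sim>\<^bsub>N\<^esub> x \<leadsto>\<^bsub>N\<^esub> \<sim>\<^bsub>N\<^esub> y \<in> D \<and> \<sim>\<^bsub>N\<^esub> y \<leadsto>\<^bsub>N\<^esub> \<sim>\<^bsub>N\<^esub> x \<in> D}"

text \<open>The operations on classes are unions over all representatives. When \<open>nelson_cong N D\<close> is a
  congruence, every member of such a union is the same class.\<close>

definition nelson_quotient :: "('a, 'b) nelson_scheme \<Rightarrow> 'a set \<Rightarrow> 'a set nelson" where
  "nelson_quotient N D =
    (let R = nelson_cong N D in
     \<lparr> carrier = carrier N // R,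
       one = R `` {\<one>\<^bsub>N\<^esub>},
       neg = (\<lambda>X. \<Union>x\<in>X. R `` {\<sim>\<^bsub>N\<^esub> x}),
       meet = (\<lambda>X Y. \<Union>x\<in>X. \<Union>y\<in>Y. R `` {x \<sqinter>\<^bsub>N\<^esub> y}),
       join = (\<lambda>X Y. \<Union>x\<in>X. \<Union>y\<in>Y. R `` {x \<squnion>\<^bsub>N\<^esub> y}),
       imp = (\<lambda>X Y. \<Union>x\<in>X. \<Union>y\<in>Y. R `` {x \<leadsto>\<^bsub>N\<^esub> y}) \<rparr>)"

text \<open>The algebra \<open>C\<^sub>n\<close>; it is meant for \<open>n \<ge> 2\<close> only.\<close>

definition nelson_chain :: "nat \<Rightarrow> rat nelson" where
  "nelson_chain n =
    \<lparr> carrier = {of_nat j / of_nat (n - 1) | j. j \<le> n - 1},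
      one = 1,
      neg = (\<lambda>x. 1 - x),
      meet = min,
      join = max,
      imp = (\<lambda>x y. if x \<le> y \<or> x \<le> 1 - x then 1 else max (1 - x) y) \<rparr>"

definition nelson_iso :: "('a, 'c) nelson_scheme \<Rightarrow> ('b, 'd) nelson_scheme \<Rightarrow> ('a \<Rightarrow> 'b) set" where
  "nelson_iso A B = {h. bij_betw h (carrier A) (carrier B) \<and>
     h \<one>\<^bsub>A\<^esub> = \<one>\<^bsub>B\<^esub> \<and>
     (\<forall>x\<in>carrier A. h (\<sim>\<^bsub>A\<^esub> x) = \<sim>\<^bsub>B\<^esub> h x) \<and>
     (\<forall>x\<in>carrier A. \<forall>y\<in>carrier A. h (x \<sqinter>\<^bsub>A\<^esub> y) = h x \<sqinter>\<^bsub>B\<^esub> h y) \<and>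
     (\<forall>x\<in>carrier A. \<forall>y\<in>carrier A. h (x \<squnion>\<^bsub>A\<^esub> y) = h x \<squnion>\<^bsub>B\<^esub> h y) \<and>
     (\<forall>x\<in>carrier A. \<forall>y\<in>carrier A. h (x \<leadsto>\<^bsub>A\<^esub> y) = h x \<leadsto>\<^bsub>B\<^esub> h y)}"

definition nelson_isomorphic :: "('a, 'c) nelson_scheme \<Rightarrow> ('b, 'd) nelson_scheme \<Rightarrow> bool" where
  "nelson_isomorphic A B \<longleftrightarrow> nelson_iso A B \<noteq> {}"

end

theory Submission
  imports Defs
begin

text \<open>For a deductive system \<open>D\<close>, the relation \<open>x \<leadsto> y \<in> D\<close> is a Heyting preorder; if \<open>D\<close> is
  irreducible, then \<open>x \<squnion> y \<in> D\<close> implies \<open>x \<in> D\<close> or \<open>y \<in> D\<close>. The five-valued identity then makes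
  the preorder linear with at most three levels \<open>0, 1, 2\<close>. Writing \<open>v x\<close> for the level of \<open>x\<close>, one
  of \<open>v x\<close>, \<open>v (\<sim> x)\<close> is always \<open>0\<close>, so \<open>v x - v (\<sim> x)\<close> embeds \<open>N / D\<close> into the five-element
  chain of ranks \<open>-2, \<dots>, 2\<close>, with an image closed under \<open>j \<mapsto> - j\<close> and containing \<open>2\<close>: one of the
  four chains. Conversely, the identity holds in these chains, and by Zorn's lemma every \<open>t \<noteq> \<one>\<close>
  is omitted by some irreducible deductive system.\<close>

section \<open>Arithmetic of Nelson algebras\<close>

context nelson_algebra
begin

section \<open>De Morgan duality and the lattice order\<close>

lemmas closed [simp] = one_closed neg_closed meet_closed join_closed imp_closed

abbreviation le :: "'a \<Rightarrow> 'a \<Rightarrow> bool"  (infix \<open>\<sqsubseteq>\<close> 50)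
  where "x \<sqsubseteq> y \<equiv> x \<sqinter> y = x"

text \<open>Negating both sides of an axiom at negated arguments gives its order dual. The other
  dual lattice laws below use the same device.\<close>

lemma neg_join:
  assumes [simp]: "x \<in> carrier N" "y \<in> carrier N"
  shows "\<sim> (x \<squnion> y) = \<sim> x \<sqinter> \<sim> y"
  using arg_cong[OF neg_meet[of "\<sim> x" "\<sim> y"], of "neg N"] by (simp add: neg_neg)

lemma join_meet_absorb:
  assumes [simp]: "x \<in> carrier N" "y \<in> carrier N"
  shows "x \<squnion> (x \<sqinter> y) = x"
  using arg_cong[OF meet_join_absorb[of "\<sim> x" "\<sim> y"], of "neg N"]
  by (simp add: neg_meet neg_join neg_neg)

lemma meet_idem: "x \<in> carrier N \<Longrightarrow> x \<sqinter> x = x"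
  using meet_join_absorb[of x "x \<sqinter> x"] by (simp add: join_meet_absorb)

lemma join_idem: "x \<in> carrier N \<Longrightarrow> x \<squnion> x = x"
  using join_meet_absorb[of x x] by (simp add: meet_idem)

text \<open>Commutativity is hidden in the distributive axiom, which swaps its factors: for
  \<open>z = y\<close> both joins collapse by idempotence.\<close>

lemma meet_comm: "x \<in> carrier N \<Longrightarrow> y \<in> carrier N \<Longrightarrow> x \<sqinter> y = y \<sqinter> x"
  using meet_join_distrib[of x y y] by (simp add: join_idem)

lemma join_comm: "x \<in> carrier N \<Longrightarrow> y \<in> carrier N \<Longrightarrow> x \<squnion> y = y \<squnion> x"
  using arg_cong[OF meet_comm[of "\<sim> x" "\<sim> y"], of "neg N"]
  by (simp add: neg_meet neg_neg)

lemma join_meet_distrib: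
  assumes [simp]: "x \<in> carrier N" "y \<in> carrier N" "z \<in> carrier N"
  shows "x \<squnion> (y \<sqinter> z) = (z \<squnion> x) \<sqinter> (y \<squnion> x)"
  using arg_cong[OF meet_join_distrib[of "\<sim> x" "\<sim> y" "\<sim> z"], of "neg N"]
  by (simp add: neg_meet neg_join neg_neg)

lemma le_iff_join: "x \<in> carrier N \<Longrightarrow> y \<in> carrier N \<Longrightarrow> x \<sqsubseteq> y \<longleftrightarrow> x \<squnion> y = y"
  using join_meet_absorb[of y x] meet_join_absorb[of x y]
  by (auto simp: meet_comm[of y x] join_comm[of y x])

text \<open>Associativity is not among the axioms, so transitivity comes from distributivity:
  \<open>z\<close> is replaced by \<open>y \<squnion> z\<close>, and absorption removes the extra
  term.\<close>

lemma le_trans: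
  assumes "x \<sqsubseteq> y" "y \<sqsubseteq> z" and [simp]: "x \<in> carrier N" "y \<in> carrier N" "z \<in> carrier N"
  shows "x \<sqsubseteq> z"
proof -
  have "x \<sqinter> z = x \<sqinter> (y \<squnion> z)" using assms le_iff_join by simp
  also have "\<dots> = (x \<sqinter> z) \<squnion> x"
    using assms(1) by (simp add: meet_join_distrib meet_comm[of z] meet_comm[of y])
  also have "\<dots> = x" by (simp add: join_comm[of _ x] join_meet_absorb)
  finally show ?thesis .
qed

lemma join_ge1: "x \<in> carrier N \<Longrightarrow> y \<in> carrier N \<Longrightarrow> x \<sqsubseteq> x \<squnion> y"
  by (rule meet_join_absorb)

lemma join_ge2: "x \<in> carrier N \<Longrightarrow> y \<in> carrier N \<Longrightarrow> y \<sqsubseteq> x \<squnion> y"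
  using meet_join_absorb[of y x] by (simp add: join_comm[of y x])

lemma meet_le1: "x \<in> carrier N \<Longrightarrow> y \<in> carrier N \<Longrightarrow> x \<sqinter> y \<sqsubseteq> x"
  using join_ge2[of x "x \<sqinter> y"] by (simp add: join_meet_absorb)

lemma meet_le2: "x \<in> carrier N \<Longrightarrow> y \<in> carrier N \<Longrightarrow> x \<sqinter> y \<sqsubseteq> y"
  using meet_le1[of y x] by (simp add: meet_comm[of y x])

lemma le_meet:
  assumes "z \<sqsubseteq> x" "z \<sqsubseteq> y" and [simp]: "x \<in> carrier N" "y \<in> carrier N" "z \<in> carrier N"
  shows "z \<sqsubseteq> x \<sqinter> y"
proof -
  have "z \<squnion> (x \<sqinter> y) = x \<sqinter> y"
    using assms le_iff_join[of z x] le_iff_join[of z y]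
    by (simp add: join_meet_distrib join_comm[of _ z] meet_comm[of y])
  then show ?thesis by (simp add: le_iff_join)
qed

lemma neg_mono:
  "\<lbrakk>x \<sqsubseteq> y; x \<in> carrier N; y \<in> carrier N\<rbrakk> \<Longrightarrow> \<sim> y \<sqsubseteq> \<sim> x"
  using neg_meet[of x y] join_comm[of "\<sim> y" "\<sim> x"] le_iff_join[of "\<sim> y" "\<sim> x"]
  by simp

lemma join_le:
  assumes "x \<sqsubseteq> z" "y \<sqsubseteq> z" and [simp]: "x \<in> carrier N" "y \<in> carrier N" "z \<in> carrier N"
  shows "x \<squnion> y \<sqsubseteq> z"
proof -
  have "\<sim> z \<sqsubseteq> \<sim> (x \<squnion> y)"
    using le_meet[of "\<sim> z" "\<sim> x" "\<sim> y"] assms by (simp add: neg_join neg_mono)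
  from neg_mono[OF this] show ?thesis by (simp add: neg_neg)
qed

lemma le_join1:
  "\<lbrakk>z \<sqsubseteq> x; x \<in> carrier N; y \<in> carrier N; z \<in> carrier N\<rbrakk> \<Longrightarrow> z \<sqsubseteq> x \<squnion> y"
  using le_trans[of z x "x \<squnion> y"] join_ge1 by simp

lemma le_join2:
  "\<lbrakk>z \<sqsubseteq> y; x \<in> carrier N; y \<in> carrier N; z \<in> carrier N\<rbrakk> \<Longrightarrow> z \<sqsubseteq> x \<squnion> y"
  using le_trans[of z y "x \<squnion> y"] join_ge2 by simp

lemma meet_le_left:
  "\<lbrakk>x \<sqsubseteq> z; x \<in> carrier N; y \<in> carrier N; z \<in> carrier N\<rbrakk> \<Longrightarrow> x \<sqinter> y \<sqsubseteq> z"
  using le_trans[of "x \<sqinter> y" x z] meet_le1 by simp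

lemma meet_le_right:
  "\<lbrakk>y \<sqsubseteq> z; x \<in> carrier N; y \<in> carrier N; z \<in> carrier N\<rbrakk> \<Longrightarrow> x \<sqinter> y \<sqsubseteq> z"
  using le_trans[of "x \<sqinter> y" y z] meet_le2 by simp

lemma le_refl: "x \<in> carrier N \<Longrightarrow> x \<sqsubseteq> x"
  by (rule meet_idem)

text \<open>At \<open>y := x\<close>, \<open>meet_imp\<close> reads
  \<open>x \<sqinter> \<one> = x \<sqinter> (\<sim> x \<squnion> x)\<close>, and the right side is
  \<open>x\<close> by absorption.\<close>

lemma le_one: "x \<in> carrier N \<Longrightarrow> x \<sqsubseteq> \<one>"
  using meet_imp[of x x] join_ge2[of "\<sim> x" x] by (simp add: imp_self)

lemma zero_le: "x \<in> carrier N \<Longrightarrow> \<sim> \<one> \<sqsubseteq> x"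
  using neg_mono[OF le_one[of "\<sim> x"]] by (simp add: neg_neg)

section \<open>Implication expressed by the lattice order\<close>

lemma one_imp:
  assumes [simp]: "y \<in> carrier N"
  shows "\<one> \<leadsto> y = y"
proof -
  have "\<one> \<sqinter> (\<one> \<leadsto> y) = \<one> \<sqinter> (\<sim> \<one> \<squnion> y)" by (simp add: meet_imp)
  moreover have "\<sim> \<one> \<squnion> y = y" using zero_le[of y] le_iff_join[of "\<sim> \<one>" y] by simp
  ultimately show ?thesis
    using le_one[of y] le_one[of "\<one> \<leadsto> y"] by (simp add: meet_comm[of \<one>])
qed

lemma imp_one: "x \<in> carrier N \<Longrightarrow> x \<leadsto> \<one> = \<one>"
  using imp_imp[of x x x] by (simp add: imp_self meet_idem)

text \<open>The bridge from implications to lattice inequalities. For the converse,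
  \<open>meet_imp\<close> gives \<open>x \<sqsubseteq> x \<leadsto> y\<close>, hence
  \<open>x \<leadsto> (x \<leadsto> y) = \<one>\<close>, and \<open>imp_imp\<close> contracts the
  two occurrences of \<open>x\<close>.\<close>

lemma imp_eq_one_iff:
  assumes [simp]: "x \<in> carrier N" "y \<in> carrier N"
  shows "x \<leadsto> y = \<one> \<longleftrightarrow> x \<sqsubseteq> \<sim> x \<squnion> y"
proof
  assume "x \<leadsto> y = \<one>"
  then show "x \<sqsubseteq> \<sim> x \<squnion> y" using meet_imp[of x y] by (simp add: le_one)
next
  assume "x \<sqsubseteq> \<sim> x \<squnion> y"
  then have "x \<sqsubseteq> (x \<leadsto> y)" by (simp add: meet_imp)
  then have "x \<leadsto> (x \<leadsto> y) = \<one>"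
    using imp_imp[of x "x \<leadsto> y" "x \<leadsto> y"] by (simp add: imp_self imp_one)
  then show "x \<leadsto> y = \<one>" by (simp add: imp_imp meet_idem)
qed

lemma le_imp: "\<lbrakk>x \<sqsubseteq> y; x \<in> carrier N; y \<in> carrier N\<rbrakk> \<Longrightarrow> x \<leadsto> y = \<one>"
  by (simp add: imp_eq_one_iff le_join2)

section \<open>Negligible elements and Heyting-style deduction\<close>

lemma kleene_le:
  assumes "k \<sqsubseteq> \<sim> k" "l \<sqsubseteq> \<sim> l" and [simp]: "k \<in> carrier N" "l \<in> carrier N"
  shows "k \<sqsubseteq> \<sim> l"
proof -
  \<comment> \<open>Here \<open>k = k \<sqinter> \<sim> k\<close>, so the Kleene law applies to
    \<open>k\<close> itself.\<close>
  have "k \<sqsubseteq> l \<squnion> \<sim> l" using kleene[of k l] assms(1) by simp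
  moreover have "l \<squnion> \<sim> l = \<sim> l" using assms(2) le_iff_join[of l "\<sim> l"] by simp
  ultimately show ?thesis by simp
qed

lemma meet_neg_le:
  assumes [simp]: "x \<in> carrier N"
  shows "x \<sqinter> \<sim> x \<sqsubseteq> \<sim> (x \<sqinter> \<sim> x)"
  using meet_le1[of x "\<sim> x"] by (simp add: neg_meet neg_neg le_join2)

text \<open>By \<open>kleene_le\<close> each of \<open>k\<close>, \<open>l\<close> lies below both
  negations, hence so does their join.\<close>

lemma self_neg_join:
  assumes k: "k \<sqsubseteq> \<sim> k" and l: "l \<sqsubseteq> \<sim> l" and [simp]: "k \<in> carrier N" "l \<in> carrier N"
  shows "k \<squnion> l \<sqsubseteq> \<sim> (k \<squnion> l)"
  using kleene_le[OF k l] kleene_le[OF l k] k l by (simp add: neg_join join_le le_meet)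

text \<open>Elements \<open>k \<sqsubseteq> \<sim> k\<close> are negligible on the right of an inequality: they form an ideal by the
  Kleene law, and \<open>x \<leadsto> y\<close> does not see them.\<close>

lemma imp_eq_oneI:
  assumes c: "c \<sqsubseteq> k \<squnion> z" and k: "k \<sqsubseteq> \<sim> k"
    and [simp]: "c \<in> carrier N" "k \<in> carrier N" "z \<in> carrier N"
  shows "c \<leadsto> z = \<one>"
proof -
  have "\<sim> k \<sqinter> \<sim> z \<sqsubseteq> \<sim> c" using neg_mono[OF c] by (simp add: neg_join)
  have kz: "k \<sqsubseteq> z \<squnion> \<sim> z" using kleene[of k z] k by simp
  \<comment> \<open>The element \<open>k\<close> lies below
    \<open>\<sim> k \<sqinter> (z \<squnion> \<sim> z)\<close>. Distributing leaves one part below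
    \<open>z\<close> and one below \<open>\<sim> k \<sqinter> \<sim> z\<close>, which the
    contraposed hypothesis puts below \<open>\<sim> c\<close>.\<close>
  have "k \<sqsubseteq> \<sim> c \<squnion> z"
  proof -
    have "k \<sqsubseteq> \<sim> k \<sqinter> (z \<squnion> \<sim> z)" by (rule le_meet[OF k kz]) auto
    moreover have "\<sim> k \<sqinter> (z \<squnion> \<sim> z) = (\<sim> z \<sqinter> \<sim> k) \<squnion> (z \<sqinter> \<sim> k)"
      by (simp add: meet_join_distrib)
    moreover have "(\<sim> z \<sqinter> \<sim> k) \<squnion> (z \<sqinter> \<sim> k) \<sqsubseteq> \<sim> c \<squnion> z"
      using \<open>\<sim> k \<sqinter> \<sim> z \<sqsubseteq> \<sim> c\<close>
      by (intro join_le le_join1[of "\<sim> z \<sqinter> \<sim> k"] le_join2[of "z \<sqinter> \<sim> k"] meet_le1)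
        (auto simp: meet_comm[of "\<sim> z"])
    ultimately show ?thesis using le_trans[of k "\<sim> k \<sqinter> (z \<squnion> \<sim> z)" "\<sim> c \<squnion> z"] by simp
  qed
  then have "k \<squnion> z \<sqsubseteq> \<sim> c \<squnion> z" by (simp add: join_le join_ge2)
  with c have "c \<sqsubseteq> \<sim> c \<squnion> z" using le_trans[of c "k \<squnion> z" "\<sim> c \<squnion> z"] by simp
  then show ?thesis by (simp add: imp_eq_one_iff)
qed

text \<open>Modus ponens inside the lattice. Since \<open>meet_imp\<close> only yields
  \<open>\<sim> x \<squnion> y\<close>, the conclusion carries the negligible error
  \<open>x \<sqinter> \<sim> x\<close>.\<close>

lemma le_detach:
  assumes "c \<sqsubseteq> x" "c \<sqsubseteq> x \<leadsto> y"
    and [simp]: "x \<in> carrier N" "y \<in> carrier N" "c \<in> carrier N"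
  shows "c \<sqsubseteq> (x \<sqinter> \<sim> x) \<squnion> y"
proof -
  have "c \<sqsubseteq> x \<sqinter> (x \<leadsto> y)" using assms by (simp add: le_meet)
  then have "c \<sqsubseteq> (y \<sqinter> x) \<squnion> (\<sim> x \<sqinter> x)" by (simp add: meet_imp meet_join_distrib)
  moreover have "(y \<sqinter> x) \<squnion> (\<sim> x \<sqinter> x) \<sqsubseteq> (x \<sqinter> \<sim> x) \<squnion> y"
    by (intro join_le le_join2[of "y \<sqinter> x"] le_join1[of "\<sim> x \<sqinter> x"] meet_le1)
      (auto simp: meet_comm[of "\<sim> x"] le_refl)
  ultimately show ?thesis
    using le_trans[of c "(y \<sqinter> x) \<squnion> (\<sim> x \<sqinter> x)" "(x \<sqinter> \<sim> x) \<squnion> y"] by simp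
qed

lemma join_mono:
  assumes "x \<sqsubseteq> x'" "y \<sqsubseteq> y'"
    and "x \<in> carrier N" "y \<in> carrier N" "x' \<in> carrier N" "y' \<in> carrier N"
  shows "x \<squnion> y \<sqsubseteq> x' \<squnion> y'"
  using assms by (simp add: join_le le_join1 le_join2)

text \<open>Keeping \<open>c\<close> beside \<open>y\<close> lets a later bound on
  \<open>c \<sqinter> y\<close> be applied inside the join.\<close>

lemma le_join_meet:
  assumes "c \<sqsubseteq> k \<squnion> y" and [simp]: "c \<in> carrier N" "k \<in> carrier N" "y \<in> carrier N"
  shows "c \<sqsubseteq> k \<squnion> (c \<sqinter> y)"
proof -
  have "c \<sqsubseteq> c \<sqinter> (k \<squnion> y)" using assms by (simp add: le_meet le_refl)
  then have "c \<sqsubseteq> (y \<sqinter> c) \<squnion> (k \<sqinter> c)" by (simp add: meet_join_distrib)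
  moreover have "(y \<sqinter> c) \<squnion> (k \<sqinter> c) \<sqsubseteq> k \<squnion> (c \<sqinter> y)"
    by (intro join_le le_join2[of "y \<sqinter> c"] le_join1[of "k \<sqinter> c"] meet_le1)
      (auto simp: meet_comm[of c] le_refl)
  ultimately show ?thesis using le_trans[of c "(y \<sqinter> c) \<squnion> (k \<sqinter> c)" "k \<squnion> (c \<sqinter> y)"] by simp
qed

text \<open>Chains two detachments: the errors \<open>k\<close> and \<open>l\<close> merge into one
  negligible element, which \<open>imp_eq_oneI\<close> discards.\<close>

lemma le_two_steps:
  assumes c: "c \<sqsubseteq> k \<squnion> y" and y: "c \<sqinter> y \<sqsubseteq> l \<squnion> z" and "k \<sqsubseteq> \<sim> k" "l \<sqsubseteq> \<sim> l"
    and [simp]: "c \<in> carrier N" "k \<in> carrier N" "y \<in> carrier N" "l \<in> carrier N" "z \<in> carrier N"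
  shows "c \<leadsto> z = \<one>"
proof (rule imp_eq_oneI[of _ "k \<squnion> l"])
  have "k \<squnion> (c \<sqinter> y) \<sqsubseteq> (k \<squnion> l) \<squnion> z"
  proof (rule join_le)
    show "k \<sqsubseteq> (k \<squnion> l) \<squnion> z" by (simp add: le_join1 join_ge1)
    have "l \<squnion> z \<sqsubseteq> (k \<squnion> l) \<squnion> z" by (simp add: join_mono join_ge2 le_refl)
    with y show "c \<sqinter> y \<sqsubseteq> (k \<squnion> l) \<squnion> z"
      using le_trans[of "c \<sqinter> y" "l \<squnion> z" "(k \<squnion> l) \<squnion> z"] by simp
  qed auto
  with le_join_meet[OF c] show "c \<sqsubseteq> (k \<squnion> l) \<squnion> z"
    using le_trans[of c "k \<squnion> (c \<sqinter> y)" "(k \<squnion> l) \<squnion> z"] by simp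
  show "k \<squnion> l \<sqsubseteq> \<sim> (k \<squnion> l)" using assms by (simp add: self_neg_join)
qed auto

lemma imp_distrib:
  assumes [simp]: "x \<in> carrier N" "y \<in> carrier N" "z \<in> carrier N"
  shows "(x \<leadsto> (y \<leadsto> z)) \<leadsto> ((x \<leadsto> y) \<leadsto> (x \<leadsto> z)) = \<one>"
proof -
  \<comment> \<open>By \<open>imp_imp\<close> the nested implication is
    \<open>c \<leadsto> z\<close>, with \<open>c\<close> the meet of all antecedents. Detaching
    \<open>x\<close> and then \<open>x \<sqinter> y\<close> below \<open>c\<close> reaches
    \<open>z\<close>.\<close>
  define c where "c = ((x \<leadsto> (y \<leadsto> z)) \<sqinter> (x \<leadsto> y)) \<sqinter> x"
  have [simp]: "c \<in> carrier N" by (simp add: c_def)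
  have cx: "c \<sqsubseteq> x" and cxy: "c \<sqsubseteq> x \<leadsto> y" and cz: "c \<sqsubseteq> (x \<sqinter> y) \<leadsto> z"
    unfolding c_def imp_imp[OF assms]
    by (auto intro!: meet_le2 meet_le_left[OF meet_le2] meet_le_left[OF meet_le1])
  have "c \<sqinter> y \<sqsubseteq> x \<sqinter> y"
    using meet_le_left[OF cx, of y] by (intro le_meet) (auto simp: meet_le2)
  from le_detach[OF this meet_le_left[OF cz]]
  have "c \<sqinter> y \<sqsubseteq> ((x \<sqinter> y) \<sqinter> \<sim> (x \<sqinter> y)) \<squnion> z" by simp
  from le_two_steps[OF le_detach[OF cx cxy] this]
  have "c \<leadsto> z = \<one>" by (simp add: meet_neg_le)
  then show ?thesis
    using imp_imp[of "(x \<leadsto> (y \<leadsto> z)) \<sqinter> (x \<leadsto> y)" x z]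
      imp_imp[of "x \<leadsto> (y \<leadsto> z)" "x \<leadsto> y" "x \<leadsto> z"]
    by (simp add: c_def)
qed

lemma imp_join:
  assumes [simp]: "x \<in> carrier N" "y \<in> carrier N" "z \<in> carrier N"
  shows "(x \<leadsto> z) \<leadsto> ((y \<leadsto> z) \<leadsto> ((x \<squnion> y) \<leadsto> z)) = \<one>"
proof -
  define c where "c = ((x \<leadsto> z) \<sqinter> (y \<leadsto> z)) \<sqinter> (x \<squnion> y)"
  have [simp]: "c \<in> carrier N" by (simp add: c_def)
  have cx: "c \<sqsubseteq> x \<leadsto> z" and cy: "c \<sqsubseteq> y \<leadsto> z" and cxy: "c \<sqsubseteq> x \<squnion> y"
    unfolding c_def by (auto intro!: meet_le2 meet_le_left[OF meet_le2] meet_le_left[OF meet_le1])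
  \<comment> \<open>The parts \<open>c \<sqinter> x\<close> and \<open>c \<sqinter> y\<close> are
    detached separately; \<open>k\<close> covers both errors, so the parts can be rejoined by
    distributivity.\<close>
  define k where "k = (x \<sqinter> \<sim> x) \<squnion> (y \<sqinter> \<sim> y)"
  have [simp]: "k \<in> carrier N" by (simp add: k_def)
  have X: "c \<sqinter> x \<sqsubseteq> (x \<sqinter> \<sim> x) \<squnion> z"
    by (rule le_detach) (auto intro: meet_le2 meet_le_left[OF cx])
  have Y: "c \<sqinter> y \<sqsubseteq> (y \<sqinter> \<sim> y) \<squnion> z"
    by (rule le_detach) (auto intro: meet_le2 meet_le_left[OF cy])
  have "(x \<sqinter> \<sim> x) \<squnion> z \<sqsubseteq> k \<squnion> z" "(y \<sqinter> \<sim> y) \<squnion> z \<sqsubseteq> k \<squnion> z"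
    by (auto simp: k_def intro!: join_mono join_ge1 join_ge2 le_refl)
  with X Y have "c \<sqinter> x \<sqsubseteq> k \<squnion> z" "c \<sqinter> y \<sqsubseteq> k \<squnion> z"
    using le_trans[of "c \<sqinter> x" "(x \<sqinter> \<sim> x) \<squnion> z" "k \<squnion> z"]
      le_trans[of "c \<sqinter> y" "(y \<sqinter> \<sim> y) \<squnion> z" "k \<squnion> z"] by simp_all
  then have "(y \<sqinter> c) \<squnion> (x \<sqinter> c) \<sqsubseteq> k \<squnion> z"
    by (intro join_le) (auto simp: meet_comm[of _ c])
  moreover have "c = (y \<sqinter> c) \<squnion> (x \<sqinter> c)" using cxy by (simp add: meet_join_distrib)
  ultimately have "c \<sqsubseteq> k \<squnion> z" by simp
  then have "c \<leadsto> z = \<one>"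
    by (rule imp_eq_oneI) (auto simp: k_def intro!: self_neg_join meet_neg_le)
  then show ?thesis
    using imp_imp[of "(x \<leadsto> z) \<sqinter> (y \<leadsto> z)" "x \<squnion> y" z]
      imp_imp[of "x \<leadsto> z" "y \<leadsto> z" "(x \<squnion> y) \<leadsto> z"]
    by (simp add: c_def)
qed

lemma meet_neg_imp: "\<lbrakk>x \<in> carrier N; y \<in> carrier N\<rbrakk> \<Longrightarrow> (x \<sqinter> \<sim> x) \<leadsto> y = \<one>"
  by (rule imp_eq_oneI[of _ "x \<sqinter> \<sim> x"]) (auto simp: meet_neg_le join_ge1)

section \<open>Negated implications up to entailment\<close>

lemma neg_meet_imp:
  assumes [simp]: "x \<in> carrier N" "y \<in> carrier N"
  shows "\<sim> x \<squnion> \<sim> (x \<leadsto> y) = \<sim> x \<squnion> (x \<sqinter> \<sim> y)"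
  using arg_cong[OF meet_imp[of x y], of "neg N"] by (simp add: neg_meet neg_join neg_neg)

text \<open>Together with \<open>neg_imp_imp\<close> this makes
  \<open>\<sim> (x \<leadsto> y)\<close> interderivable with \<open>x \<sqinter> \<sim> y\<close>.
  The surplus \<open>\<sim> x\<close> from \<open>neg_meet_imp\<close> is harmless because it lies
  below \<open>\<sim> (x \<sqinter> \<sim> y)\<close>.\<close>

lemma meet_neg_imp_neg_imp:
  assumes [simp]: "x \<in> carrier N" "y \<in> carrier N"
  shows "(x \<sqinter> \<sim> y) \<leadsto> \<sim> (x \<leadsto> y) = \<one>"
proof -
  have "x \<sqinter> \<sim> y \<sqsubseteq> \<sim> x \<squnion> \<sim> (x \<leadsto> y)" by (simp add: neg_meet_imp join_ge2)
  moreover have "\<sim> x \<squnion> \<sim> (x \<leadsto> y) \<sqsubseteq> \<sim> (x \<sqinter> \<sim> y) \<squnion> \<sim> (x \<leadsto> y)"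
    by (intro join_mono) (auto simp: neg_meet neg_neg join_ge1 le_refl)
  ultimately have "x \<sqinter> \<sim> y \<sqsubseteq> \<sim> (x \<sqinter> \<sim> y) \<squnion> \<sim> (x \<leadsto> y)"
    using le_trans[of "x \<sqinter> \<sim> y" "\<sim> x \<squnion> \<sim> (x \<leadsto> y)" "\<sim> (x \<sqinter> \<sim> y) \<squnion> \<sim> (x \<leadsto> y)"] by simp
  then show ?thesis by (simp add: imp_eq_one_iff)
qed

text \<open>For \<open>t = x \<leadsto> y\<close>, \<open>neg_meet_imp\<close> puts
  \<open>\<sim> t\<close> below \<open>\<sim> x \<squnion> (x \<sqinter> \<sim> y)\<close>. The
  unwanted part \<open>\<sim> t \<sqinter> \<sim> x\<close> is negligible because
  \<open>\<sim> x \<leadsto> t = \<one>\<close>.\<close>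

lemma neg_imp_imp:
  assumes [simp]: "x \<in> carrier N" "y \<in> carrier N"
  shows "\<sim> (x \<leadsto> y) \<leadsto> (x \<sqinter> \<sim> y) = \<one>"
proof -
  define t where "t = x \<leadsto> y"
  have [simp]: "t \<in> carrier N" by (simp add: t_def)
  have "\<sim> x \<leadsto> t = \<one>"
    by (simp add: t_def imp_imp meet_comm[of "\<sim> x"] meet_neg_imp)
  then have *: "\<sim> x \<sqsubseteq> (\<sim> x \<sqinter> \<sim> (\<sim> x)) \<squnion> t"
    by (intro le_detach) (auto simp: le_one le_refl)
  \<comment> \<open>The first contradiction is the error of detaching
    \<open>\<sim> x \<leadsto> t\<close>; the second arises when the resulting \<open>t\<close>
    meets \<open>\<sim> t\<close>.\<close>
  define l where "l = (\<sim> x \<sqinter> \<sim> (\<sim> x)) \<squnion> (t \<sqinter> \<sim> t)"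
  have [simp]: "l \<in> carrier N" by (simp add: l_def)
  have "\<sim> t \<sqinter> \<sim> x \<sqsubseteq> (\<sim> x \<sqinter> \<sim> (\<sim> x)) \<squnion> t"
    using meet_le_right[OF *, of "\<sim> t"] by simp
  then have "\<sim> t \<sqinter> \<sim> x \<sqsubseteq> (\<sim> x \<sqinter> \<sim> (\<sim> x)) \<squnion> ((\<sim> t \<sqinter> \<sim> x) \<sqinter> t)"
    by (rule le_join_meet) auto
  moreover have "(\<sim> x \<sqinter> \<sim> (\<sim> x)) \<squnion> ((\<sim> t \<sqinter> \<sim> x) \<sqinter> t) \<sqsubseteq> l"
    unfolding l_def
    by (intro join_mono le_meet) (auto intro: meet_le1 meet_le2 le_refl meet_le_left[OF meet_le1])
  ultimately have tx: "\<sim> t \<sqinter> \<sim> x \<sqsubseteq> l"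
    using le_trans[of "\<sim> t \<sqinter> \<sim> x" "(\<sim> x \<sqinter> \<sim> (\<sim> x)) \<squnion> ((\<sim> t \<sqinter> \<sim> x) \<sqinter> t)" l] by simp
  have "\<sim> t \<sqsubseteq> \<sim> x \<squnion> (x \<sqinter> \<sim> y)"
    using neg_meet_imp[of x y] join_ge2[of "\<sim> x" "\<sim> t"] by (simp add: t_def)
  then have t: "\<sim> t \<sqsubseteq> (x \<sqinter> \<sim> y) \<squnion> \<sim> x" by (simp add: join_comm)
  have "\<sim> t \<sqsubseteq> (x \<sqinter> \<sim> y) \<squnion> (\<sim> t \<sqinter> \<sim> x)" by (rule le_join_meet[OF t]) auto
  moreover have "(x \<sqinter> \<sim> y) \<squnion> (\<sim> t \<sqinter> \<sim> x) \<sqsubseteq> (x \<sqinter> \<sim> y) \<squnion> l"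
    using tx by (intro join_mono) (auto simp: le_refl)
  ultimately have "\<sim> t \<sqsubseteq> l \<squnion> (x \<sqinter> \<sim> y)"
    using le_trans[of "\<sim> t" "(x \<sqinter> \<sim> y) \<squnion> (\<sim> t \<sqinter> \<sim> x)" "(x \<sqinter> \<sim> y) \<squnion> l"]
    by (simp add: join_comm[of l])
  then show ?thesis unfolding t_def[symmetric]
    by (rule imp_eq_oneI) (auto simp: l_def intro!: self_neg_join meet_neg_le)
qed

end

section \<open>The Heyting preorder of a deductive system\<close>

locale nelson_deductive = nelson_algebra +
  fixes D
  assumes ded: "deductive_system D N"
begin

abbreviation ent :: "'a \<Rightarrow> 'a \<Rightarrow> bool"  (infix \<open>\<turnstile>\<close> 50)
  where "x \<turnstile> y \<equiv> x \<leadsto> y \<in> D"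

lemma one_mem [simp]: "\<one> \<in> D"
  using ded by (simp add: deductive_system_def)

lemma mem_carrier: "x \<in> D \<Longrightarrow> x \<in> carrier N"
  using ded by (auto simp: deductive_system_def)

lemma detach: "\<lbrakk>x \<turnstile> y; x \<in> D; y \<in> carrier N\<rbrakk> \<Longrightarrow> y \<in> D"
  using ded by (auto simp: deductive_system_def)

lemma le_ent: "\<lbrakk>x \<sqsubseteq> y; x \<in> carrier N; y \<in> carrier N\<rbrakk> \<Longrightarrow> x \<turnstile> y"
  by (simp add: le_imp)

lemma ent_refl: "x \<in> carrier N \<Longrightarrow> x \<turnstile> x"
  by (simp add: imp_self)

lemma ent_mem: "\<lbrakk>y \<in> D; x \<in> carrier N\<rbrakk> \<Longrightarrow> x \<turnstile> y"
  by (rule detach[of y]) (auto simp: mem_carrier imp_imp le_ent meet_le1)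

text \<open>Modus ponens under a hypothesis \<open>x\<close>; transitivity and the behaviour of
  meets rest on it.\<close>

lemma ent_distrib:
  assumes "x \<turnstile> y \<leadsto> z" "x \<turnstile> y" "x \<in> carrier N" "y \<in> carrier N" "z \<in> carrier N"
  shows "x \<turnstile> z"
  using detach[OF detach[of "x \<leadsto> (y \<leadsto> z)" "(x \<leadsto> y) \<leadsto> (x \<leadsto> z)"]] assms
  by (simp add: imp_distrib)

lemma ent_trans:
  "\<lbrakk>x \<turnstile> y; y \<turnstile> z; x \<in> carrier N; y \<in> carrier N; z \<in> carrier N\<rbrakk> \<Longrightarrow> x \<turnstile> z"
  using ent_distrib[of x y z] ent_mem[of "y \<leadsto> z" x] by simp

lemma ent_meet:
  assumes "z \<turnstile> x" "z \<turnstile> y" "x \<in> carrier N" "y \<in> carrier N" "z \<in> carrier N"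
  shows "z \<turnstile> x \<sqinter> y"
proof -
  have "x \<leadsto> (y \<leadsto> (x \<sqinter> y)) = \<one>" using assms by (simp add: imp_imp imp_self)
  then have "x \<turnstile> y \<leadsto> (x \<sqinter> y)" by simp
  then have "z \<turnstile> y \<leadsto> (x \<sqinter> y)" using ent_trans[of z x "y \<leadsto> (x \<sqinter> y)"] assms by simp
  then show ?thesis using ent_distrib[of z y "x \<sqinter> y"] assms by simp
qed

lemma join_ent:
  assumes "x \<turnstile> z" "y \<turnstile> z" "x \<in> carrier N" "y \<in> carrier N" "z \<in> carrier N"
  shows "x \<squnion> y \<turnstile> z"
  using detach[OF detach[of "x \<leadsto> z" "(y \<leadsto> z) \<leadsto> ((x \<squnion> y) \<leadsto> z)"]] assms
  by (simp add: imp_join)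

lemma meet_ent1: "\<lbrakk>x \<in> carrier N; y \<in> carrier N\<rbrakk> \<Longrightarrow> x \<sqinter> y \<turnstile> x"
  by (simp add: le_ent meet_le1)

lemma meet_ent2: "\<lbrakk>x \<in> carrier N; y \<in> carrier N\<rbrakk> \<Longrightarrow> x \<sqinter> y \<turnstile> y"
  by (simp add: le_ent meet_le2)

lemma ent_join1: "\<lbrakk>x \<in> carrier N; y \<in> carrier N\<rbrakk> \<Longrightarrow> x \<turnstile> x \<squnion> y"
  by (simp add: le_ent join_ge1)

lemma ent_join2: "\<lbrakk>x \<in> carrier N; y \<in> carrier N\<rbrakk> \<Longrightarrow> y \<turnstile> x \<squnion> y"
  by (simp add: le_ent join_ge2)

lemma meet_mono_ent:
  assumes "x \<turnstile> x'" "y \<turnstile> y'"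
    and "x \<in> carrier N" "y \<in> carrier N" "x' \<in> carrier N" "y' \<in> carrier N"
  shows "x \<sqinter> y \<turnstile> x' \<sqinter> y'"
  using assms ent_meet ent_trans[of "x \<sqinter> y" x x'] ent_trans[of "x \<sqinter> y" y y']
  by (simp add: meet_ent1 meet_ent2)

lemma join_mono_ent:
  assumes "x \<turnstile> x'" "y \<turnstile> y'"
    and "x \<in> carrier N" "y \<in> carrier N" "x' \<in> carrier N" "y' \<in> carrier N"
  shows "x \<squnion> y \<turnstile> x' \<squnion> y'"
  using assms join_ent ent_trans[of x x' "x' \<squnion> y'"] ent_trans[of y y' "x' \<squnion> y'"]
  by (simp add: ent_join1 ent_join2)

lemma imp_mono_ent:
  assumes "x' \<turnstile> x" "y \<turnstile> y'"
    and [simp]: "x \<in> carrier N" "y \<in> carrier N" "x' \<in> carrier N" "y' \<in> carrier N"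
  shows "x \<leadsto> y \<turnstile> x' \<leadsto> y'"
proof -
  have "(x \<leadsto> y) \<sqinter> x' \<turnstile> (x \<leadsto> y) \<sqinter> x" using assms(1) by (simp add: meet_mono_ent ent_refl)
  moreover have "(x \<leadsto> y) \<sqinter> x \<turnstile> y" by (simp add: imp_imp[symmetric] ent_refl)
  ultimately have "(x \<leadsto> y) \<sqinter> x' \<turnstile> y"
    using ent_trans[of "(x \<leadsto> y) \<sqinter> x'" "(x \<leadsto> y) \<sqinter> x" y] by simp
  then have "(x \<leadsto> y) \<sqinter> x' \<turnstile> y'"
    using ent_trans[of "(x \<leadsto> y) \<sqinter> x'" y y'] assms(2) by simp
  then show ?thesis by (simp add: imp_imp)
qed

section \<open>The congruence of a deductive system and its quotient\<close>

abbreviation cong (infix \<open>\<equiv>\<^sub>D\<close> 50) where "x \<equiv>\<^sub>D y \<equiv> (x, y) \<in> nelson_cong N D"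

lemma nelson_cong_iff:
  "x \<equiv>\<^sub>D y \<longleftrightarrow> x \<in> carrier N \<and> y \<in> carrier N \<and> x \<turnstile> y \<and> y \<turnstile> x \<and> \<sim> x \<turnstile> \<sim> y \<and> \<sim> y \<turnstile> \<sim> x"
  by (simp add: nelson_cong_def)

lemma cong_equiv: "equiv (carrier N) (nelson_cong N D)"
proof (rule equivI)
  show "nelson_cong N D \<subseteq> carrier N \<times> carrier N" by (auto simp: nelson_cong_def)
  show "refl_on (carrier N) (nelson_cong N D)"
    by (auto simp: refl_on_def nelson_cong_def imp_self)
  show "sym (nelson_cong N D)" by (auto simp: sym_def nelson_cong_def)
  show "trans (nelson_cong N D)"
  proof (rule transI)
    fix x y z assume "x \<equiv>\<^sub>D y" "y \<equiv>\<^sub>D z"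
    then show "x \<equiv>\<^sub>D z"
      using ent_trans[of x y z] ent_trans[of z y x]
        ent_trans[of "\<sim> x" "\<sim> y" "\<sim> z"] ent_trans[of "\<sim> z" "\<sim> y" "\<sim> x"]
      by (simp add: nelson_cong_iff)
  qed
qed

lemma cong_neg: "x \<equiv>\<^sub>D y \<Longrightarrow> \<sim> x \<equiv>\<^sub>D \<sim> y"
  by (simp add: nelson_cong_iff neg_neg)

lemma cong_meet: "\<lbrakk>x \<equiv>\<^sub>D x'; y \<equiv>\<^sub>D y'\<rbrakk> \<Longrightarrow> x \<sqinter> y \<equiv>\<^sub>D x' \<sqinter> y'"
  by (simp add: nelson_cong_iff neg_meet meet_mono_ent join_mono_ent)

lemma cong_join: "\<lbrakk>x \<equiv>\<^sub>D x'; y \<equiv>\<^sub>D y'\<rbrakk> \<Longrightarrow> x \<squnion> y \<equiv>\<^sub>D x' \<squnion> y'"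
  by (simp add: nelson_cong_iff neg_join meet_mono_ent join_mono_ent)

lemma neg_imp_ent:
  "\<lbrakk>x \<in> carrier N; y \<in> carrier N\<rbrakk> \<Longrightarrow> \<sim> (x \<leadsto> y) \<turnstile> x \<sqinter> \<sim> y"
  by (simp add: neg_imp_imp)

lemma ent_neg_imp:
  "\<lbrakk>x \<in> carrier N; y \<in> carrier N\<rbrakk> \<Longrightarrow> x \<sqinter> \<sim> y \<turnstile> \<sim> (x \<leadsto> y)"
  by (simp add: meet_neg_imp_neg_imp)

text \<open>Monotonicity is read off from \<open>x \<sqinter> \<sim> y\<close>, which is
  interderivable with the negated implication. This handles the negated half of
  \<open>cong_imp\<close>.\<close>

lemma neg_imp_mono_ent:
  assumes "x \<turnstile> x'" "\<sim> y \<turnstile> \<sim> y'"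
    and [simp]: "x \<in> carrier N" "y \<in> carrier N" "x' \<in> carrier N" "y' \<in> carrier N"
  shows "\<sim> (x \<leadsto> y) \<turnstile> \<sim> (x' \<leadsto> y')"
proof -
  have "\<sim> (x \<leadsto> y) \<turnstile> x' \<sqinter> \<sim> y'"
    using ent_trans[OF neg_imp_ent[of x y] meet_mono_ent[of x x' "\<sim> y" "\<sim> y'"]] assms by simp
  then show ?thesis using ent_trans[OF _ ent_neg_imp[of x' y']] by simp
qed

lemma cong_imp: "\<lbrakk>x \<equiv>\<^sub>D x'; y \<equiv>\<^sub>D y'\<rbrakk> \<Longrightarrow> x \<leadsto> y \<equiv>\<^sub>D x' \<leadsto> y'"
  by (simp add: nelson_cong_iff imp_mono_ent neg_imp_mono_ent)

abbreviation cls where "cls x \<equiv> nelson_cong N D `` {x}"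

lemma quotient_one: "one (nelson_quotient N D) = cls \<one>"
  by (simp add: nelson_quotient_def Let_def)

lemma quotient_carrier: "carrier (nelson_quotient N D) = cls ` carrier N"
  by (auto simp: nelson_quotient_def Let_def quotient_def)

lemma quotient_neg: "x \<in> carrier N \<Longrightarrow> neg (nelson_quotient N D) (cls x) = cls (\<sim> x)"
  unfolding nelson_quotient_def Let_def
  by (simp, rule UN_equiv_class[OF cong_equiv])
    (auto simp: congruent_def intro!: equiv_class_eq[OF cong_equiv] cong_neg)

lemma quotient_meet:
  "\<lbrakk>x \<in> carrier N; y \<in> carrier N\<rbrakk> \<Longrightarrow> meet (nelson_quotient N D) (cls x) (cls y) = cls (x \<sqinter> y)"
  unfolding nelson_quotient_def Let_def
  by (simp, rule UN_equiv_class2[OF cong_equiv cong_equiv])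
    (auto simp: congruent2_def intro!: equiv_class_eq[OF cong_equiv] cong_meet)

lemma quotient_join:
  "\<lbrakk>x \<in> carrier N; y \<in> carrier N\<rbrakk> \<Longrightarrow> join (nelson_quotient N D) (cls x) (cls y) = cls (x \<squnion> y)"
  unfolding nelson_quotient_def Let_def
  by (simp, rule UN_equiv_class2[OF cong_equiv cong_equiv])
    (auto simp: congruent2_def intro!: equiv_class_eq[OF cong_equiv] cong_join)

lemma quotient_imp:
  "\<lbrakk>x \<in> carrier N; y \<in> carrier N\<rbrakk> \<Longrightarrow> imp (nelson_quotient N D) (cls x) (cls y) = cls (x \<leadsto> y)"
  unfolding nelson_quotient_def Let_def
  by (simp, rule UN_equiv_class2[OF cong_equiv cong_equiv])
    (auto simp: congruent2_def intro!: equiv_class_eq[OF cong_equiv] cong_imp)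

text \<open>The homomorphism theorem: a surjective homomorphism whose kernel is the congruence
  factors through a bijection of the classes.\<close>

lemma quotient_isomorphicI:
  assumes img: "f ` carrier N = carrier B"
    and ker: "\<And>x y. \<lbrakk>x \<in> carrier N; y \<in> carrier N\<rbrakk> \<Longrightarrow> f x = f y \<longleftrightarrow> x \<equiv>\<^sub>D y"
    and "f \<one> = \<one>\<^bsub>B\<^esub>"
    and "\<And>x. x \<in> carrier N \<Longrightarrow> f (\<sim> x) = \<sim>\<^bsub>B\<^esub> f x"
    and "\<And>x y. \<lbrakk>x \<in> carrier N; y \<in> carrier N\<rbrakk> \<Longrightarrow> f (x \<sqinter> y) = f x \<sqinter>\<^bsub>B\<^esub> f y"
    and "\<And>x y. \<lbrakk>x \<in> carrier N; y \<in> carrier N\<rbrakk> \<Longrightarrow> f (x \<squnion> y) = f x \<squnion>\<^bsub>B\<^esub> f y"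
    and "\<And>x y. \<lbrakk>x \<in> carrier N; y \<in> carrier N\<rbrakk> \<Longrightarrow> f (x \<leadsto> y) = f x \<leadsto>\<^bsub>B\<^esub> f y"
  shows "nelson_isomorphic (nelson_quotient N D) B"
proof -
  define h where "h X = the_elem (f ` X)" for X
  have h [simp]: "h (cls x) = f x" if "x \<in> carrier N" for x
  proof -
    have "f y = f x" if "x \<equiv>\<^sub>D y" for y
      using that ker[of x y] by (simp add: nelson_cong_iff)
    then have "f ` cls x = {f x}"
      using equiv_class_self[OF cong_equiv that] by blast
    then show ?thesis by (simp add: h_def)
  qed
  have "inj_on h (cls ` carrier N)"
  proof (rule inj_onI)
    fix X Y assume "X \<in> cls ` carrier N" "Y \<in> cls ` carrier N" and eq: "h X = h Y"
    then obtain x y where "x \<in> carrier N" "y \<in> carrier N" "X = cls x" "Y = cls y" by blast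
    then show "X = Y" using eq ker[of x y] equiv_class_eq[OF cong_equiv, of x y] by simp
  qed
  moreover have "h ` cls ` carrier N = carrier B"
    unfolding img[symmetric] image_image by (rule image_cong) simp_all
  ultimately have "h \<in> nelson_iso (nelson_quotient N D) B"
    unfolding nelson_iso_def bij_betw_def quotient_carrier quotient_one
    using assms(3-)
    by (simp add: quotient_neg quotient_meet quotient_join quotient_imp)
  then show ?thesis by (auto simp: nelson_isomorphic_def)
qed

end

section \<open>Quotients by irreducible deductive systems\<close>

lemma carrier_nelson_chain: "carrier (nelson_chain n) = (\<lambda>j. of_nat j / of_nat (n - 1)) ` {..n - 1}"
  by (auto simp: nelson_chain_def)

locale nelson_irreducible = nelson_deductive +
  assumes irr: "irreducible_deductive_system D N"
begin

text \<open>This set is the deductive system generated by \<open>D\<close> and \<open>x\<close>;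
  closure under detachment is \<open>ent_distrib\<close>.\<close>

lemma deductive_system_ent:
  assumes [simp]: "x \<in> carrier N"
  shows "deductive_system {z \<in> carrier N. x \<turnstile> z} N"
  unfolding deductive_system_def using ent_distrib[of x] by (auto simp: imp_one)

text \<open>The systems generated by \<open>D\<close> with \<open>x\<close> and by \<open>D\<close>
  with \<open>y\<close> intersect in \<open>D\<close>, by \<open>join_ent\<close>. Irreducibility
  makes one of them equal to \<open>D\<close>, which then contains its generator.\<close>

lemma prime:
  assumes "x \<squnion> y \<in> D" and [simp]: "x \<in> carrier N" "y \<in> carrier N"
  shows "x \<in> D \<or> y \<in> D"
proof -
  have "D = {z \<in> carrier N. x \<turnstile> z} \<inter> {z \<in> carrier N. y \<turnstile> z}"
  proof (intro equalityI subsetI)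
    fix z assume "z \<in> D"
    then show "z \<in> {z \<in> carrier N. x \<turnstile> z} \<inter> {z \<in> carrier N. y \<turnstile> z}"
      by (simp add: mem_carrier ent_mem)
  next
    fix z assume "z \<in> {z \<in> carrier N. x \<turnstile> z} \<inter> {z \<in> carrier N. y \<turnstile> z}"
    then show "z \<in> D" using join_ent[of x z y] detach[OF _ assms(1)] by simp
  qed
  then have "D = {z \<in> carrier N. x \<turnstile> z} \<or> D = {z \<in> carrier N. y \<turnstile> z}"
    using deductive_system_ent[of x] deductive_system_ent[of y] irr assms(2,3)
    unfolding irreducible_deductive_system_def by blast
  moreover have "x \<in> {z \<in> carrier N. x \<turnstile> z}" "y \<in> {z \<in> carrier N. y \<turnstile> z}"
    by (simp_all add: ent_refl)
  ultimately show ?thesis by blast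
qed

lemma zero_notin: "\<sim> \<one> \<notin> D"
proof
  assume "\<sim> \<one> \<in> D"
  then have "y \<in> D" if "y \<in> carrier N" for y
    using detach[of "\<sim> \<one>" y] that by (simp add: le_ent zero_le)
  then show False using irr mem_carrier by (auto simp: irreducible_deductive_system_def)
qed

end

locale five_valued_nelson_irreducible = nelson_irreducible + five_valued_nelson_algebra
begin

text \<open>Substituting \<open>y := (a \<leadsto> b) \<squnion> (b \<leadsto> a)\<close>, \<open>x := a\<close>, \<open>z := b\<close> in the identity yields \<open>y \<in> D\<close>.\<close>

lemma linear:
  assumes [simp]: "a \<in> carrier N" "b \<in> carrier N"
  shows "a \<turnstile> b \<or> b \<turnstile> a"
proof -
  define y where "y = (a \<leadsto> b) \<squnion> (b \<leadsto> a)"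
  have [simp]: "y \<in> carrier N" by (simp add: y_def)
  have ab: "a \<leadsto> b \<turnstile> y" and ba: "b \<leadsto> a \<turnstile> y" by (simp_all add: y_def ent_join1 ent_join2)
  \<comment> \<open>From \<open>b \<turnstile> y\<close>, contravariance gives
    \<open>y \<leadsto> a \<turnstile> b \<leadsto> a\<close>. This puts the second antecedent of
    the identity, \<open>(y \<leadsto> a) \<leadsto> y\<close>, into \<open>D\<close>.\<close>
  have "b \<turnstile> a \<leadsto> b" by (simp add: imp_imp meet_ent1)
  then have "b \<turnstile> y" using ent_trans[OF _ ab] by simp
  then have "y \<leadsto> a \<turnstile> b \<leadsto> a" by (simp add: imp_mono_ent ent_refl)
  then have "y \<leadsto> a \<turnstile> y" using ent_trans[OF _ ba] by simp
  moreover have "(a \<leadsto> b) \<leadsto> y \<turnstile> ((y \<leadsto> a) \<leadsto> y) \<leadsto> y" using five_valued[of a y b] by simp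
  ultimately have "y \<in> D" using ab detach[of "(a \<leadsto> b) \<leadsto> y"] detach[of "(y \<leadsto> a) \<leadsto> y" y] by simp
  then show ?thesis using prime[of "a \<leadsto> b" "b \<leadsto> a"] by (simp add: y_def)
qed

text \<open>Rules out two distinct intermediate levels. If \<open>x\<close> were strictly below
  \<open>y\<close>, linearity and contraction would give
  \<open>x \<leadsto> \<sim> \<one> \<turnstile> y\<close> and
  \<open>y \<leadsto> x \<turnstile> y\<close>; the identity with \<open>z := \<sim> \<one>\<close>
  would then put \<open>y\<close> into \<open>D\<close>.\<close>

lemma intermediate_ent:
  assumes x: "\<not> x \<turnstile> \<sim> \<one>" and y: "y \<notin> D" and [simp]: "x \<in> carrier N" "y \<in> carrier N"
  shows "y \<turnstile> x"
proof (rule ccontr)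
  assume yx: "\<not> y \<turnstile> x"
  then have xy: "x \<turnstile> y" using linear[of x y] by simp
  have "x \<leadsto> \<sim> \<one> \<turnstile> y"
  proof (rule ccontr)
    assume "\<not> ?thesis"
    then have "y \<turnstile> x \<leadsto> \<sim> \<one>" using linear[of y "x \<leadsto> \<sim> \<one>"] by simp
    then have "x \<turnstile> x \<leadsto> \<sim> \<one>" using ent_trans[OF xy] by simp
    with x show False by (simp add: imp_imp meet_idem)
  qed
  moreover have "y \<leadsto> x \<turnstile> y"
  proof (rule ccontr)
    assume "\<not> ?thesis"
    then have "y \<turnstile> y \<leadsto> x" using linear[of y "y \<leadsto> x"] by simp
    with yx show False by (simp add: imp_imp meet_idem)
  qed
  moreover have "(x \<leadsto> \<sim> \<one>) \<leadsto> y \<turnstile> ((y \<leadsto> x) \<leadsto> y) \<leadsto> y"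
    using five_valued[of x y "\<sim> \<one>"] by simp
  ultimately have "y \<in> D"
    using detach[of "(x \<leadsto> \<sim> \<one>) \<leadsto> y"] detach[of "(y \<leadsto> x) \<leadsto> y" y] by simp
  with y show False ..
qed

section \<open>The three levels and the signed rank\<close>

definition lev :: "'a \<Rightarrow> int"
  where "lev x = (if x \<in> D then 2 else if x \<turnstile> \<sim> \<one> then 0 else 1)"

lemma lev_cases: "lev x = 0 \<or> lev x = 1 \<or> lev x = 2"
  by (simp add: lev_def)

lemma lev_nonneg: "0 \<le> lev x"
  by (simp add: lev_def)

lemma lev_eq_2: "lev x = 2 \<longleftrightarrow> x \<in> D"
  by (simp add: lev_def)

lemma lev_eq_0: "x \<in> carrier N \<Longrightarrow> lev x = 0 \<longleftrightarrow> x \<turnstile> \<sim> \<one>"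
  using zero_notin detach[of x "\<sim> \<one>"] by (auto simp: lev_def)

lemma lev_le_iff:
  assumes [simp]: "x \<in> carrier N" "y \<in> carrier N"
  shows "lev x \<le> lev y \<longleftrightarrow> x \<turnstile> y"
proof
  assume le: "lev x \<le> lev y"
  consider "y \<in> D" | "y \<notin> D" "x \<turnstile> \<sim> \<one>" | "y \<notin> D" "\<not> x \<turnstile> \<sim> \<one>" by blast
  then show "x \<turnstile> y"
  proof cases
    case 1
    then show ?thesis by (simp add: ent_mem)
  next
    case 2
    then show ?thesis using ent_trans[of x "\<sim> \<one>" y] by (simp add: le_ent zero_le)
  next
    \<comment> \<open>Both elements have level 1 here, so their equivalence needs
      \<open>intermediate_ent\<close>.\<close>
    case 3
    with le have "x \<notin> D" "\<not> y \<turnstile> \<sim> \<one>" by (auto simp: lev_def split: if_splits)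
    then show ?thesis by (simp add: intermediate_ent)
  qed
next
  assume "x \<turnstile> y"
  then have "x \<in> D \<Longrightarrow> y \<in> D" "y \<turnstile> \<sim> \<one> \<Longrightarrow> x \<turnstile> \<sim> \<one>"
    using detach ent_trans[of x y "\<sim> \<one>"] by auto
  then show "lev x \<le> lev y" by (auto simp: lev_def)
qed

lemma lev_meet:
  assumes [simp]: "x \<in> carrier N" "y \<in> carrier N"
  shows "lev (x \<sqinter> y) = min (lev x) (lev y)"
proof -
  have "lev (x \<sqinter> y) \<le> lev x" "lev (x \<sqinter> y) \<le> lev y"
    by (simp_all add: lev_le_iff meet_ent1 meet_ent2)
  moreover have "lev x \<le> lev (x \<sqinter> y) \<or> lev y \<le> lev (x \<sqinter> y)"
    using linear[of x y] by (auto simp: lev_le_iff ent_meet ent_refl)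
  ultimately show ?thesis by linarith
qed

lemma lev_join:
  assumes [simp]: "x \<in> carrier N" "y \<in> carrier N"
  shows "lev (x \<squnion> y) = max (lev x) (lev y)"
proof -
  have "lev x \<le> lev (x \<squnion> y)" "lev y \<le> lev (x \<squnion> y)"
    by (simp_all add: lev_le_iff ent_join1 ent_join2)
  moreover have "lev (x \<squnion> y) \<le> lev x \<or> lev (x \<squnion> y) \<le> lev y"
    using linear[of x y] by (auto simp: lev_le_iff join_ent ent_refl)
  ultimately show ?thesis by linarith
qed

text \<open>Goedel implication on a three-element chain. If \<open>x\<close> does not entail
  \<open>y\<close>, contraction excludes \<open>x \<turnstile> x \<leadsto> y\<close>; linearity
  then gives \<open>x \<leadsto> y \<turnstile> x\<close>, and detaching gives
  \<open>x \<leadsto> y \<turnstile> y\<close>.\<close>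

lemma lev_imp:
  assumes [simp]: "x \<in> carrier N" "y \<in> carrier N"
  shows "lev (x \<leadsto> y) = (if lev x \<le> lev y then 2 else lev y)"
proof (cases "x \<turnstile> y")
  case True
  then show ?thesis by (simp add: lev_le_iff lev_eq_2)
next
  case False
  have "x \<leadsto> y \<turnstile> x \<or> x \<turnstile> x \<leadsto> y" by (rule linear) auto
  with False have "x \<leadsto> y \<turnstile> x" by (simp add: imp_imp meet_idem)
  then have "x \<leadsto> y \<turnstile> (x \<leadsto> y) \<sqinter> x" by (simp add: ent_meet ent_refl)
  moreover have "(x \<leadsto> y) \<sqinter> x \<turnstile> y" by (simp add: imp_imp[symmetric] ent_refl)
  ultimately have "x \<leadsto> y \<turnstile> y" using ent_trans[of "x \<leadsto> y" "(x \<leadsto> y) \<sqinter> x" y] by simp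
  moreover have "y \<turnstile> x \<leadsto> y" by (simp add: imp_imp meet_ent1)
  ultimately have "lev (x \<leadsto> y) = lev y" by (simp add: lev_le_iff[symmetric])
  with False show ?thesis by (simp add: lev_le_iff)
qed

lemma lev_neg_imp:
  assumes [simp]: "x \<in> carrier N" "y \<in> carrier N"
  shows "lev (\<sim> (x \<leadsto> y)) = min (lev x) (lev (\<sim> y))"
proof -
  have "lev (\<sim> (x \<leadsto> y)) = lev (x \<sqinter> \<sim> y)"
    using neg_imp_ent[of x y] ent_neg_imp[of x y] by (simp add: lev_le_iff[symmetric])
  then show ?thesis by (simp add: lev_meet)
qed

text \<open>The contradiction \<open>x \<sqinter> \<sim> x\<close> entails everything, and its level
  is the minimum of the two.\<close>

lemma lev_neg_disjoint:
  assumes [simp]: "x \<in> carrier N"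
  shows "lev x = 0 \<or> lev (\<sim> x) = 0"
proof -
  have "lev (x \<sqinter> \<sim> x) = 0" by (simp add: lev_eq_0 meet_neg_imp)
  then show ?thesis by (simp add: lev_meet min_def split: if_splits)
qed

text \<open>The pair \<open>(lev x, lev (\<sim> x))\<close> has a zero entry, so its difference determines it.\<close>

definition rank :: "'a \<Rightarrow> int" where "rank x = lev x - lev (\<sim> x)"

lemma rank_range: "rank x \<in> {-2, -1, 0, 1, 2}" if "x \<in> carrier N"
  using lev_neg_disjoint[OF that] lev_cases[of x] lev_cases[of "\<sim> x"] by (auto simp: rank_def)

lemma rank_one: "rank \<one> = 2"
  using lev_neg_disjoint[of \<one>] lev_eq_2[of \<one>] by (simp add: rank_def)

lemma rank_neg: "x \<in> carrier N \<Longrightarrow> rank (\<sim> x) = - rank x"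
  by (simp add: rank_def neg_neg)

lemma rank_meet:
  assumes "x \<in> carrier N" "y \<in> carrier N"
  shows "rank (x \<sqinter> y) = min (rank x) (rank y)"
  using assms lev_neg_disjoint[of x] lev_neg_disjoint[of y]
    lev_nonneg[of x] lev_nonneg[of y] lev_nonneg[of "\<sim> x"] lev_nonneg[of "\<sim> y"]
  by (auto simp: rank_def lev_meet lev_join neg_meet)

lemma rank_join:
  assumes "x \<in> carrier N" "y \<in> carrier N"
  shows "rank (x \<squnion> y) = max (rank x) (rank y)"
  using assms lev_neg_disjoint[of x] lev_neg_disjoint[of y]
    lev_nonneg[of x] lev_nonneg[of y] lev_nonneg[of "\<sim> x"] lev_nonneg[of "\<sim> y"]
  by (auto simp: rank_def lev_meet lev_join neg_join)

text \<open>The chain implication with its centre moved from 1/2 to 0. The condition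
  \<open>rank x \<le> - rank x\<close> amounts to \<open>lev x = 0\<close>, by
  \<open>lev_neg_disjoint\<close>.\<close>

lemma rank_imp:
  assumes "x \<in> carrier N" "y \<in> carrier N"
  shows "rank (x \<leadsto> y) =
    (if rank x \<le> rank y \<or> rank x \<le> - rank x then 2 else max (- rank x) (rank y))"
  using assms lev_neg_disjoint[of x] lev_neg_disjoint[of y]
    lev_nonneg[of x] lev_nonneg[of y] lev_nonneg[of "\<sim> x"] lev_nonneg[of "\<sim> y"]
  by (auto simp: rank_def lev_imp lev_neg_imp)

lemma rank_eq_iff:
  assumes "x \<in> carrier N" "y \<in> carrier N"
  shows "rank x = rank y \<longleftrightarrow> x \<equiv>\<^sub>D y"
proof -
  have "rank x = rank y \<longleftrightarrow> lev x = lev y \<and> lev (\<sim> x) = lev (\<sim> y)"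
    using assms lev_neg_disjoint[of x] lev_neg_disjoint[of y]
      lev_nonneg[of x] lev_nonneg[of y] lev_nonneg[of "\<sim> x"] lev_nonneg[of "\<sim> y"]
    by (auto simp: rank_def)
  also have "\<dots> \<longleftrightarrow> x \<equiv>\<^sub>D y" using assms by (auto simp: nelson_cong_iff lev_le_iff[symmetric])
  finally show ?thesis .
qed

text \<open>A rescaling \<open>e\<close> of ranks that respects order, reflection and the top
  carries the rank operations to those of the chain; only its image depends on
  \<open>n\<close>.\<close>

lemma quotient_isomorphic_chain:
  assumes img: "(\<lambda>x. e (rank x)) ` carrier N = carrier (nelson_chain n)"
    and e2: "e 2 = 1"
    and neg: "\<And>j. e (- j) = 1 - e j"
    and less: "\<And>j k. j < k \<Longrightarrow> e j < e k"
  shows "nelson_isomorphic (nelson_quotient N D) (nelson_chain n)"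
proof -
  have sm: "strict_mono e" using less by (simp add: strict_mono_def)
  have le: "e j \<le> e k \<longleftrightarrow> j \<le> k" for j k by (rule strict_mono_less_eq[OF sm])
  have min: "e (min j k) = min (e j) (e k)" and max: "e (max j k) = max (e j) (e k)" for j k
    by (simp_all add: min_def max_def le)
  \<comment> \<open>This translates \<open>e j \<le> 1 - e j\<close>, the second condition in the
    chain implication, back to ranks.\<close>
  have neg_le: "2 * e j \<le> 1 \<longleftrightarrow> j \<le> 0" for j
    using le[of j "- j"] by (simp add: neg)
  show ?thesis
  proof (rule quotient_isomorphicI[OF img])
    show "e (rank x) = e (rank y) \<longleftrightarrow> x \<equiv>\<^sub>D y" if "x \<in> carrier N" "y \<in> carrier N" for x y
      using that strict_mono_eq[OF sm] by (simp add: rank_eq_iff)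
  next
    fix x y assume "x \<in> carrier N" "y \<in> carrier N"
    then show "e (rank (x \<leadsto> y)) = e (rank x) \<leadsto>\<^bsub>nelson_chain n\<^esub> e (rank y)"
      by (simp add: nelson_chain_def rank_imp e2 neg le max neg_le)
  qed (simp_all add: nelson_chain_def rank_one e2 rank_neg neg rank_meet rank_join min max)
qed

lemma quotient_is_chain:
  "\<exists>i::nat. 2 \<le> i \<and> i \<le> 5 \<and> nelson_isomorphic (nelson_quotient N D) (nelson_chain i)"
proof -
  define S where "S = rank ` carrier N"
  have sub: "S \<subseteq> {-2, -1, 0, 1, 2}" using rank_range by (auto simp: S_def)
  have neg: "- j \<in> S" if "j \<in> S" for j
    using that by (auto simp: S_def rank_neg[symmetric])
  have two: "2 \<in> S" by (auto simp: S_def image_iff rank_one intro!: bexI[of _ \<one>])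
  have img: "(\<lambda>x. e (rank x)) ` carrier N = e ` S" for e :: "int \<Rightarrow> rat"
    by (auto simp: S_def)
  \<comment> \<open>\<open>e\<close> spaces all five ranks equally, \<open>e'\<close> the four nonzero ones.\<close>
  define e where "e j = (of_int j + 2) / (4 :: rat)" for j :: int
  define e' where "e' j = 1 / 2 + (2 * of_int j - of_int (sgn j)) / (6 :: rat)" for j :: int
  have e: "nelson_isomorphic (nelson_quotient N D) (nelson_chain n)"
    if "e ` S = (\<lambda>j. of_nat j / of_nat (n - 1)) ` {..n - 1}" for n
  proof (rule quotient_isomorphic_chain[of e])
    show "(\<lambda>x. e (rank x)) ` carrier N = carrier (nelson_chain n)"
      by (simp only: img that carrier_nelson_chain)
  qed (auto simp: e_def field_simps)
  have e': "nelson_isomorphic (nelson_quotient N D) (nelson_chain n)"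
    if "e' ` S = (\<lambda>j. of_nat j / of_nat (n - 1)) ` {..n - 1}" for n
  proof (rule quotient_isomorphic_chain[of e'])
    show "(\<lambda>x. e' (rank x)) ` carrier N = carrier (nelson_chain n)"
      by (simp only: img that carrier_nelson_chain)
  qed (auto simp: e'_def field_simps sgn_if)
  \<comment> \<open>Symmetry and \<open>2 \<in> S\<close> leave only the membership of 0 and of 1
    open.\<close>
  consider "S = {-2, -1, 0, 1, 2}" | "S = {-2, -1, 1, 2}" | "S = {-2, 0, 2}" | "S = {-2, 2}"
  proof -
    have "-2 \<in> S" using neg[OF two] by simp
    moreover have "-1 \<in> S \<longleftrightarrow> 1 \<in> S" using neg[of 1] neg[of "-1"] by auto
    ultimately show ?thesis using sub two that by (cases "0 \<in> S"; cases "1 \<in> S") blast+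
  qed
  then show ?thesis
  proof cases
    case 1
    then have "nelson_isomorphic (nelson_quotient N D) (nelson_chain 5)"
      by (intro e) (auto simp: e_def atMost_nat_numeral)
    then show ?thesis by (intro exI[of _ 5]) simp
  next
    case 2
    then have "nelson_isomorphic (nelson_quotient N D) (nelson_chain 4)"
      by (intro e') (auto simp: e'_def atMost_nat_numeral)
    then show ?thesis by (intro exI[of _ 4]) simp
  next
    case 3
    then have "nelson_isomorphic (nelson_quotient N D) (nelson_chain 3)"
      by (intro e) (auto simp: e_def atMost_nat_numeral)
    then show ?thesis by (intro exI[of _ 3]) simp
  next
    case 4
    then have "nelson_isomorphic (nelson_quotient N D) (nelson_chain 2)"
      by (intro e) (auto simp: e_def atMost_Suc)
    then show ?thesis by (intro exI[of _ 2]) simp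
  qed
qed

end

section \<open>Separation by irreducible deductive systems\<close>

context nelson_algebra
begin

text \<open>Zorn's lemma gives a \<open>D\<close> maximal among the systems omitting
  \<open>t\<close>. If \<open>D = D1 \<inter> D2\<close>, one factor omits \<open>t\<close> and
  equals \<open>D\<close> by maximality.\<close>

lemma ex_irreducible_deductive_system:
  assumes t: "t \<in> carrier N" "t \<noteq> \<one>"
  obtains D where "irreducible_deductive_system D N" "t \<notin> D"
proof -
  define F where "F = {D. deductive_system D N \<and> t \<notin> D}"
  have "{\<one>} \<in> F" using t by (auto simp: F_def deductive_system_def one_imp)
  moreover have "\<Union>C \<in> F" if "C \<noteq> {}" "subset.chain F C" for C
  proof -
    have C: "C \<subseteq> F" and lin: "\<And>X Y. X \<in> C \<Longrightarrow> Y \<in> C \<Longrightarrow> X \<subseteq> Y \<or> Y \<subseteq> X"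
      using that(2) unfolding subset_chain_def by blast+
    have "\<forall>x\<in>carrier N. \<forall>y\<in>carrier N. x \<in> \<Union>C \<longrightarrow> x \<leadsto> y \<in> \<Union>C \<longrightarrow> y \<in> \<Union>C"
    proof (intro ballI impI)
      fix x y assume xy: "x \<in> carrier N" "y \<in> carrier N" "x \<in> \<Union>C" "x \<leadsto> y \<in> \<Union>C"
      from xy(3,4) obtain X Y where XY: "X \<in> C" "Y \<in> C" "x \<in> X" "x \<leadsto> y \<in> Y" by blast
      \<comment> \<open>The larger of the two chain members contains both premises.\<close>
      with lin[of X Y] obtain Z where "Z \<in> C" "x \<in> Z" "x \<leadsto> y \<in> Z" by blast
      moreover have "deductive_system Z N" using C \<open>Z \<in> C\<close> by (auto simp: F_def)
      ultimately have "y \<in> Z" using xy(1,2) unfolding deductive_system_def by blast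
      with \<open>Z \<in> C\<close> show "y \<in> \<Union>C" by blast
    qed
    moreover have "\<Union>C \<subseteq> carrier N" "t \<notin> \<Union>C" using C by (auto simp: F_def deductive_system_def)
    moreover have "\<one> \<in> \<Union>C"
    proof -
      from \<open>C \<noteq> {}\<close> obtain X where "X \<in> C" by blast
      with C have "\<one> \<in> X" by (auto simp: F_def deductive_system_def)
      with \<open>X \<in> C\<close> show ?thesis by blast
    qed
    ultimately show ?thesis by (simp only: F_def deductive_system_def mem_Collect_eq simp_thms)
  qed
  ultimately have "\<exists>M\<in>F. \<forall>X\<in>F. M \<subseteq> X \<longrightarrow> X = M"
    by (intro subset_Zorn_nonempty) auto
  then obtain D where D: "D \<in> F" and max: "\<And>X. X \<in> F \<Longrightarrow> D \<subseteq> X \<Longrightarrow> X = D"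
    by blast
  have "irreducible_deductive_system D N"
    unfolding irreducible_deductive_system_def
  proof (intro conjI allI impI)
    show "deductive_system D N" "D \<noteq> carrier N" using D t by (auto simp: F_def)
    fix D1 D2
    assume "deductive_system D1 N" "deductive_system D2 N" "D = D1 \<inter> D2"
    moreover from this have "t \<notin> D1 \<or> t \<notin> D2" using D by (simp add: F_def)
    ultimately have "D1 \<in> F \<or> D2 \<in> F" "D \<subseteq> D1" "D \<subseteq> D2" by (simp_all add: F_def)
    then show "D = D1 \<or> D = D2" using max[of D1] max[of D2] by blast
  qed
  moreover have "t \<notin> D" using D by (simp add: F_def)
  ultimately show thesis by (rule that)
qed

end

section \<open>The identity in the chains and its transfer back\<close>

lemma nelson_chain_five_valued:
  assumes "2 \<le> i" "i \<le> 5"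
    and "x \<in> carrier (nelson_chain i)" "y \<in> carrier (nelson_chain i)" "z \<in> carrier (nelson_chain i)"
  defines "I \<equiv> imp (nelson_chain i)"
  shows "I (I (I x z) y) (I (I (I y x) y) y) = 1"
proof -
  have I: "I = (\<lambda>x y. if x \<le> y \<or> x \<le> 1 - x then 1 else max (1 - x) y)"
    by (simp add: I_def nelson_chain_def)
  \<comment> \<open>A finite check: listing each chain leaves at most 125 triples to
    evaluate.\<close>
  have "i \<in> {2, 3, 4, 5}" using assms(1,2) by auto
  then consider "i = 2" | "i = 3" | "i = 4" | "i = 5" by blast
  then show ?thesis
  proof cases
    case 1
    then have "x \<in> {0, 1}" "y \<in> {0, 1}" "z \<in> {0, 1}"
      using assms(3-5) by (auto simp: carrier_nelson_chain atMost_Suc)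
    then show ?thesis by (elim insertE emptyE) (simp_all add: I)
  next
    case 2
    then have "x \<in> {0, 1/2, 1}" "y \<in> {0, 1/2, 1}" "z \<in> {0, 1/2, 1}"
      using assms(3-5) by (auto simp: carrier_nelson_chain atMost_nat_numeral)
    then show ?thesis by (elim insertE emptyE) (simp_all add: I)
  next
    case 3
    then have "x \<in> {0, 1/3, 2/3, 1}" "y \<in> {0, 1/3, 2/3, 1}" "z \<in> {0, 1/3, 2/3, 1}"
      using assms(3-5) by (auto simp: carrier_nelson_chain atMost_nat_numeral)
    then show ?thesis by (elim insertE emptyE) (simp_all add: I)
  next
    case 4
    then have "x \<in> {0, 1/4, 1/2, 3/4, 1}" "y \<in> {0, 1/4, 1/2, 3/4, 1}" "z \<in> {0, 1/4, 1/2, 3/4, 1}"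
      using assms(3-5) by (auto simp: carrier_nelson_chain atMost_nat_numeral)
    then show ?thesis by (elim insertE emptyE) (simp_all add: I)
  qed
qed

text \<open>A value \<open>t\<close> of the left side other than \<open>\<one>\<close> would be
  omitted by some irreducible \<open>D\<close>. The chain isomorphic to the quotient satisfies the
  identity, so \<open>t\<close> is congruent to \<open>\<one>\<close> and lies in \<open>D\<close>
  after all.\<close>

lemma (in nelson_algebra) five_valued_if_quotients_chains:
  assumes chains: "\<And>D. irreducible_deductive_system D N \<Longrightarrow>
      \<exists>i::nat. 2 \<le> i \<and> i \<le> 5 \<and> nelson_isomorphic (nelson_quotient N D) (nelson_chain i)"
    and [simp]: "x \<in> carrier N" "y \<in> carrier N" "z \<in> carrier N"
  shows "((x \<leadsto> z) \<leadsto> y) \<leadsto> (((y \<leadsto> x) \<leadsto> y) \<leadsto> y) = \<one>" (is "?t = \<one>")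
proof (rule ccontr)
  assume "?t \<noteq> \<one>"
  then obtain D where D: "irreducible_deductive_system D N" "?t \<notin> D"
    by (rule ex_irreducible_deductive_system[rotated]) auto
  then interpret nelson_deductive N D
    by unfold_locales (simp add: irreducible_deductive_system_def)
  from chains[OF D(1)] obtain i h where i: "2 \<le> i" "i \<le> 5"
    and h: "h \<in> nelson_iso (nelson_quotient N D) (nelson_chain i)"
    by (auto simp: nelson_isomorphic_def)
  \<comment> \<open>The projection followed by the isomorphism. The identity involves only
    \<open>\<leadsto>\<close> and \<open>\<one>\<close>, so \<open>f_imp\<close> evaluates it in the
    chain.\<close>
  define f where "f a = h (cls a)" for a
  define I where "I = imp (nelson_chain i)"
  have f_imp: "f (a \<leadsto> b) = I (f a) (f b)" if "a \<in> carrier N" "b \<in> carrier N" for a b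
    using h that by (simp add: nelson_iso_def quotient_carrier f_def I_def flip: quotient_imp)
  have f_carrier: "f a \<in> carrier (nelson_chain i)" if "a \<in> carrier N" for a
    using h that by (auto simp: nelson_iso_def quotient_carrier f_def bij_betw_def)
  have "f ?t = 1"
    using nelson_chain_five_valued[OF i f_carrier f_carrier f_carrier, of x y z]
    by (simp add: f_imp I_def)
  also have "1 = f \<one>"
    using h by (simp add: nelson_iso_def quotient_one f_def nelson_chain_def)
  finally have "cls ?t = cls \<one>"
    using h unfolding f_def nelson_iso_def bij_betw_def quotient_carrier
    by (auto dest!: inj_onD)
  then have "(?t, \<one>) \<in> nelson_cong N D"
    using eq_equiv_class_iff[OF cong_equiv, of ?t \<one>] by simp
  then have "\<one> \<leadsto> ?t \<in> D" by (simp add: nelson_cong_iff)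
  then have "?t \<in> D" using detach[of \<one> ?t] by simp
  with D(2) show False ..
qed

theorem theorem3p36:
  fixes N :: "('a, 'b) nelson_scheme"
  assumes "nelson_algebra N"
  shows "five_valued_nelson_algebra N \<longleftrightarrow>
    (\<forall>D. irreducible_deductive_system D N \<longrightarrow>
      (\<exists>i::nat. 2 \<le> i \<and> i \<le> 5 \<and> nelson_isomorphic (nelson_quotient N D) (nelson_chain i)))"
proof (intro iffI allI impI)
  fix D assume "five_valued_nelson_algebra N" and D: "irreducible_deductive_system D N"
  then interpret five_valued_nelson_algebra N by simp
  interpret five_valued_nelson_irreducible N D
    using D by unfold_locales (simp_all add: irreducible_deductive_system_def)
  show "\<exists>i::nat. 2 \<le> i \<and> i \<le> 5 \<and> nelson_isomorphic (nelson_quotient N D) (nelson_chain i)"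
    by (rule quotient_is_chain)
next
  interpret nelson_algebra N by (rule assms)
  assume "\<forall>D. irreducible_deductive_system D N \<longrightarrow>
    (\<exists>i::nat. 2 \<le> i \<and> i \<le> 5 \<and> nelson_isomorphic (nelson_quotient N D) (nelson_chain i))"
  then show "five_valued_nelson_algebra N"
    by unfold_locales (rule five_valued_if_quotients_chains, blast+)
qed

end
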